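(* Let $\gamma(s)$ be an arclength parametrized curve fully immersed in $\mathbb{R}^3$. If $\gamma$ is a proper concircular helix, then there exists a rectifying curve $\alpha$ such that $\gamma$ is (congruent to) a geodesic of the tangent surface to $\alpha$.
   Context: Fully immersed in $\mathbb{R}^3$ means not contained in a plane. For a unit speed curve, the curvature $\kappa$, torsion $\tau$ and Frenet frame $\{T,N,B=T\times N\}$ satisfy the Frenet equations $T'=\kappa N$, $N'=-\kappa T+\tau B$, $B'=-\tau N$; a subscript indicates the curve. A concircular vector field on $\mathbb{R}^3$ is a vector field $Y(p)=\mu p+v$ with constants $\mu\in\mathbb{R}$, $v\in\mathbb{R}^3$. A (non geodesic) unit speed curve $\gamma$ is a concircular helix with axis $Y$ if $\lambda=\langle N_\gamma,Y\rangle$ is constant along $\gamma$, $N_\gamma$ being its principal normal. It is a proper concircular helix if it is neither a generalized helix (tangents making a constant angle with a fixed direction), nor a slant helix (principal normals making a constant angle with a fixed direction), nor a rectifying curve; in other words, a proper concircular helix is a concircular helix with $\lambda\mu\neq0$. A rectifying curve is a curve $\alpha$ whose position vector (with respect to some fixed origin) always lies in its rectifying plane, the plane spanned by $T_\alpha$ and $B_\alpha$; for $\kappa_\alpha>0$ this is equivalent to $(\tau_\alpha/\kappa_\alpha)(u)=c_1u+c_0$ with constants $c_1\neq0$ and $c_0$, where $u$ is the arclength parameter. The tangent surface to a unit speed curve $\alpha(u)$ is the surface $Z(u,v)=\alpha(u)+(v-u)\,T_\alpha(u)$, $v\neq u$. Congruent means equal up to a rigid motion of $\mathbb{R}^3$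.
   Formalization: As stated the claim fails where the first or second derivative of torsion/curvature vanishes; it is proved on every interval where neither vanishes (exactly where it can hold), and otherwise for some subarc of every arc on which the curve is a proper concircular helix. *)

theory Defs
  imports "HOL-Analysis.Analysis"
begin

unbundle cross3_syntax

text \<open>Curves are maps on a nonempty open interval of parameters, possibly unbounded; values
  outside the interval are irrelevant.\<close>

definition open_interval :: "real set \<Rightarrow> bool" where
  "open_interval I \<longleftrightarrow> open I \<and> is_interval I \<and> I \<noteq> {}"

definition vderiv :: "(real \<Rightarrow> 'a::real_normed_vector) \<Rightarrow> real \<Rightarrow> 'a" where
  "vderiv f s = vector_derivative f (at s)"

text \<open>Smooth means infinitely differentiable; used only for open \<open>I\<close>.\<close>

definition smooth_on :: "real set \<Rightarrow> (real \<Rightarrow> 'a::real_normed_vector) \<Rightarrow> bool" where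
  "smooth_on I f \<longleftrightarrow> (\<forall>n. \<forall>s\<in>I. (vderiv ^^ n) f differentiable (at s))"


section \<open>Frenet apparatus of a unit speed curve\<close>

definition frenet_T :: "(real \<Rightarrow> real^3) \<Rightarrow> real \<Rightarrow> real^3" where
  "frenet_T \<gamma> = vderiv \<gamma>"

definition curvature :: "(real \<Rightarrow> real^3) \<Rightarrow> real \<Rightarrow> real" where
  "curvature \<gamma> s = norm (vderiv (frenet_T \<gamma>) s)"

definition frenet_N :: "(real \<Rightarrow> real^3) \<Rightarrow> real \<Rightarrow> real^3" where
  "frenet_N \<gamma> s = vderiv (frenet_T \<gamma>) s /\<^sub>R curvature \<gamma> s"

definition frenet_B :: "(real \<Rightarrow> real^3) \<Rightarrow> real \<Rightarrow> real^3" where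
  "frenet_B \<gamma> s = frenet_T \<gamma> s \<times> frenet_N \<gamma> s"

text \<open>The sign is that of \<open>N' = - \<kappa> T + \<tau> B\<close>.\<close>

definition torsion :: "(real \<Rightarrow> real^3) \<Rightarrow> real \<Rightarrow> real" where
  "torsion \<gamma> s = vderiv (frenet_N \<gamma>) s \<bullet> frenet_B \<gamma> s"

text \<open>This ratio is constant exactly for generalized helices, and a nonconstant affine function of
  arclength exactly for rectifying curves. For a concircular helix with \<open>\<lambda> \<mu> \<noteq> 0\<close>, the points where
  its first or second derivative vanishes are those where the edge of regression of the rectifying
  developable escapes to infinity or is singular; around such a point the curve is not a geodesic
  of the tangent surface to any rectifying curve.\<close>

definition torsion_ratio :: "(real \<Rightarrow> real^3) \<Rightarrow> real \<Rightarrow> real" where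
  "torsion_ratio \<gamma> s = torsion \<gamma> s / curvature \<gamma> s"

text \<open>A smooth non-geodesic unit speed curve: positive curvature, so that the Frenet frame is
  defined along the whole curve.\<close>

definition frenet_curve :: "(real \<Rightarrow> real^3) \<Rightarrow> real set \<Rightarrow> bool" where
  "frenet_curve \<gamma> I \<longleftrightarrow> open_interval I \<and> smooth_on I \<gamma> \<and>
     (\<forall>s\<in>I. norm (frenet_T \<gamma> s) = 1 \<and> curvature \<gamma> s > 0)"

definition fully_immersed :: "(real \<Rightarrow> real^3) \<Rightarrow> real set \<Rightarrow> bool" where
  "fully_immersed \<gamma> I \<longleftrightarrow> \<not> (\<exists>a b. a \<noteq> 0 \<and> \<gamma> ` I \<subseteq> {x. a \<bullet> x = b})"


section \<open>Helices and rectifying curves\<close>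

definition generalized_helix :: "(real \<Rightarrow> real^3) \<Rightarrow> real set \<Rightarrow> bool" where
  "generalized_helix \<gamma> I \<longleftrightarrow> frenet_curve \<gamma> I \<and>
     (\<exists>a c. norm a = 1 \<and> (\<forall>s\<in>I. frenet_T \<gamma> s \<bullet> a = c))"

definition slant_helix :: "(real \<Rightarrow> real^3) \<Rightarrow> real set \<Rightarrow> bool" where
  "slant_helix \<gamma> I \<longleftrightarrow> frenet_curve \<gamma> I \<and>
     (\<exists>a c. norm a = 1 \<and> (\<forall>s\<in>I. frenet_N \<gamma> s \<bullet> a = c))"

definition rectifying_curve :: "(real \<Rightarrow> real^3) \<Rightarrow> real set \<Rightarrow> bool" where
  "rectifying_curve \<gamma> I \<longleftrightarrow> frenet_curve \<gamma> I \<and>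
     (\<exists>origin. \<forall>s\<in>I. \<gamma> s - origin \<in> span {frenet_T \<gamma> s, frenet_B \<gamma> s})"

definition concircular_field :: "real \<Rightarrow> real^3 \<Rightarrow> real^3 \<Rightarrow> real^3" where
  "concircular_field \<mu> v p = \<mu> *\<^sub>R p + v"

definition concircular_helix ::
    "(real \<Rightarrow> real^3) \<Rightarrow> real set \<Rightarrow> real \<Rightarrow> real^3 \<Rightarrow> real \<Rightarrow> bool" where
  "concircular_helix \<gamma> I \<mu> v l \<longleftrightarrow> frenet_curve \<gamma> I \<and>
     (\<forall>s\<in>I. frenet_N \<gamma> s \<bullet> concircular_field \<mu> v (\<gamma> s) = l)"

text \<open>The exclusion of the three degenerate classes is stated in addition to \<open>\<lambda> \<mu> \<noteq> 0\<close>: a circular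
  helix is a generalized helix, yet for \<open>Y(p) = p\<close>, with the origin on its axis, \<open>\<lambda> \<mu> \<noteq> 0\<close>.
  Conversely, for a nonzero field the exclusion implies \<open>\<lambda> \<mu> \<noteq> 0\<close>.\<close>

definition proper_concircular_helix :: "(real \<Rightarrow> real^3) \<Rightarrow> real set \<Rightarrow> bool" where
  "proper_concircular_helix \<gamma> I \<longleftrightarrow>
     (\<exists>\<mu> v l. concircular_helix \<gamma> I \<mu> v l \<and> l * \<mu> \<noteq> 0) \<and>
     \<not> generalized_helix \<gamma> I \<and> \<not> slant_helix \<gamma> I \<and> \<not> rectifying_curve \<gamma> I"


section \<open>Geodesics of the tangent surface\<close>

definition tangent_surface :: "(real \<Rightarrow> real^3) \<Rightarrow> real \<Rightarrow> real \<Rightarrow> real^3" where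
  "tangent_surface \<alpha> u v = \<alpha> u + (v - u) *\<^sub>R frenet_T \<alpha> u"

definition tangent_surface_dom :: "real set \<Rightarrow> (real \<times> real) set" where
  "tangent_surface_dom L = {(u, v). u \<in> L \<and> v \<noteq> u}"

text \<open>A curve \<open>\<gamma> s = Z (u s) (v s)\<close> in a parametrized surface is a geodesic if its acceleration
  is orthogonal to the tangent plane, which is spanned by the partial derivatives of \<open>Z\<close>.\<close>

definition geodesic_of_surface ::
    "(real \<Rightarrow> real \<Rightarrow> real^3) \<Rightarrow> (real \<times> real) set \<Rightarrow> (real \<Rightarrow> real^3) \<Rightarrow> real set \<Rightarrow> bool" where
  "geodesic_of_surface Z D \<gamma> J \<longleftrightarrow>
     (\<exists>u v :: real \<Rightarrow> real. smooth_on J u \<and> smooth_on J v \<and>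
        (\<forall>s\<in>J. (u s, v s) \<in> D \<and> \<gamma> s = Z (u s) (v s) \<and>
           vderiv (vderiv \<gamma>) s \<bullet> vderiv (\<lambda>x. Z x (v s)) (u s) = 0 \<and>
           vderiv (vderiv \<gamma>) s \<bullet> vderiv (\<lambda>y. Z (u s) y) (v s) = 0))"

definition rigid_motion :: "(real^3 \<Rightarrow> real^3) \<Rightarrow> bool" where
  "rigid_motion \<Phi> \<longleftrightarrow> (\<exists>A b. rotation_matrix A \<and> \<Phi> = (\<lambda>x. A *v x + b))"

definition congruent_to_tangent_surface_geodesic ::
    "(real \<Rightarrow> real^3) \<Rightarrow> real set \<Rightarrow> (real \<Rightarrow> real^3) \<Rightarrow> real set \<Rightarrow> bool" where
  "congruent_to_tangent_surface_geodesic \<gamma> J \<alpha> L \<longleftrightarrow>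
     (\<exists>\<Phi>. rigid_motion \<Phi> \<and>
        geodesic_of_surface (tangent_surface \<alpha>) (tangent_surface_dom L) (\<Phi> \<circ> \<gamma>) J)"

end

theory Submission
  imports Defs
begin

text \<open>
  Dividing the field by \<open>\<mu>\<close> and moving its zero to a point \<open>p\<close>, a concircular helix with
  \<open>\<mu> \<noteq> 0\<close> is a curve for which \<open>N \<bullet> (\<gamma> - p)\<close> is constant. A curve is a geodesic of any surface
  whose tangent plane along it is spanned by \<open>T\<close> and \<open>B\<close>, and one such surface is its rectifying
  developable, ruled by the lines through \<open>\<gamma> s\<close> along the (rescaled) Darboux vector
  \<open>W = \<rho> T + B\<close>, where \<open>\<rho> = \<tau> / \<kappa>\<close>. The claim is that this developable is the tangent surface of a
  rectifying curve.

  Since \<open>W' = \<rho>' T\<close>, the only point of the ruling that can move along the ruling itself is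
  \<open>A = \<gamma> - W / \<rho>'\<close>, for which \<open>A' = (\<rho>'' / \<rho>'\<^sup>2) W\<close>. So where \<open>\<rho>'\<close> and \<open>\<rho>''\<close> do not vanish, \<open>A\<close> is a
  regular curve with unit tangent \<open>E = W / norm W\<close> up to sign, and the developable is its tangent surface. The
  principal normal of \<open>A\<close> is parallel to \<open>E'\<close>, hence to \<open>T - \<rho> B\<close>. Differentiating
  \<open>N \<bullet> (\<gamma> - p) = const\<close> gives exactly \<open>(\<gamma> - p) \<bullet> (T - \<rho> B) = 0\<close>, and \<open>W\<close> is orthogonal to
  \<open>T - \<rho> B\<close> too, so \<open>A - p\<close> is orthogonal to the principal normal of \<open>A\<close>: the edge \<open>A\<close> is a
  rectifying curve with origin \<open>p\<close>. Its arclength comes for free: \<open>u = E \<bullet> (A - p)\<close> has derivative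
  \<open>E \<bullet> A'\<close>, because \<open>E' \<bullet> (A - p) = 0\<close>. This is carried out in \<open>geodesic_if_regular\<close>.

  It remains to find points with \<open>\<rho>' \<rho>'' \<noteq> 0\<close> (\<open>exists_regular_subinterval\<close>). If there were none,
  \<open>\<rho>'\<^sup>2\<close> would have derivative zero and \<open>\<rho>'\<close> would be constant. If \<open>\<rho>' = 0\<close>, then \<open>W\<close> is a fixed
  direction and \<open>\<gamma>\<close> is a generalized helix; if \<open>\<rho>'\<close> is a nonzero constant, then \<open>A\<close> is a
  fixed point and \<open>\<gamma> - A\<close> is a multiple of \<open>W\<close>, so \<open>\<gamma>\<close> is a rectifying curve. A proper concircular
  helix is neither.
\<close>

section \<open>Calculus of smooth functions of one variable\<close>

text \<open>Closure properties of smooth functions are proved for finitely many derivatives, where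
  induction on their number is available: the derivative of a product, a quotient, a square root
  or an inverse function is again built from functions with fewer derivatives.\<close>

definition smooth_upto :: "nat \<Rightarrow> real set \<Rightarrow> (real \<Rightarrow> 'a::real_normed_vector) \<Rightarrow> bool" where
  "smooth_upto n I f \<longleftrightarrow> (\<forall>m\<le>n. \<forall>s\<in>I. (vderiv ^^ m) f differentiable (at s))"

lemma smooth_on_iff_smooth_upto: "smooth_on I f \<longleftrightarrow> (\<forall>n. smooth_upto n I f)"
  unfolding smooth_on_def smooth_upto_def by blast

lemma vderivI: "(f has_vector_derivative f') (at s) \<Longrightarrow> vderiv f s = f'"
  unfolding vderiv_def by (rule vector_derivative_at)

lemma has_vderiv: "f differentiable (at s) \<Longrightarrow> (f has_vector_derivative vderiv f s) (at s)"
  unfolding vderiv_def by (simp add: vector_derivative_works)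

lemma smooth_upto_0: "smooth_upto 0 I f \<longleftrightarrow> (\<forall>s\<in>I. f differentiable (at s))"
  by (simp add: smooth_upto_def)

lemma smooth_upto_Suc:
  "smooth_upto (Suc n) I f \<longleftrightarrow> (\<forall>s\<in>I. f differentiable (at s)) \<and> smooth_upto n I (vderiv f)"
proof -
  have "(vderiv ^^ Suc m) f = (vderiv ^^ m) (vderiv f)" for m
    by (simp only: funpow_Suc_right o_apply)
  moreover have "(\<forall>m\<le>Suc n. P m) \<longleftrightarrow> P 0 \<and> (\<forall>m\<le>n. P (Suc m))" for P
  proof safe
    fix m assume "P 0" "\<forall>m\<le>n. P (Suc m)" "m \<le> Suc n"
    then show "P m" by (cases m) auto
  qed auto
  ultimately show ?thesis
    unfolding smooth_upto_def by auto
qed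

lemma smooth_upto_differentiable: "smooth_upto n I f \<Longrightarrow> s \<in> I \<Longrightarrow> f differentiable (at s)"
  by (cases n) (auto simp: smooth_upto_0 smooth_upto_Suc)

lemma smooth_upto_Suc_imp: "smooth_upto (Suc n) I f \<Longrightarrow> smooth_upto n I f"
  unfolding smooth_upto_def by simp

lemma has_vector_derivative_cong_open:
  fixes f g :: "real \<Rightarrow> 'a::real_normed_vector"
  assumes "open I" "\<And>s. s \<in> I \<Longrightarrow> f s = g s" "s \<in> I"
  shows "(f has_vector_derivative d) (at s) \<longleftrightarrow> (g has_vector_derivative d) (at s)"
  using has_vector_derivative_transform_within_open[OF _ assms(1,3), of f d g]
    has_vector_derivative_transform_within_open[OF _ assms(1,3), of g d f] assms(2) by auto

lemma vderiv_cong: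
  assumes "open I" "\<And>s. s \<in> I \<Longrightarrow> f s = g s" "s \<in> I"
  shows "vderiv f s = vderiv g s"
  unfolding vderiv_def vector_derivative_def
  by (simp only: has_vector_derivative_cong_open[OF assms])

lemma differentiable_cong_open:
  fixes f g :: "real \<Rightarrow> 'a::real_normed_vector"
  assumes "open I" "\<And>s. s \<in> I \<Longrightarrow> f s = g s" "s \<in> I" "f differentiable (at s)"
  shows "g differentiable (at s)"
proof -
  have "(g has_vector_derivative vderiv f s) (at s)"
    using has_vderiv[OF assms(4)] has_vector_derivative_cong_open[OF assms(1-3)] by simp
  then show ?thesis by (rule differentiableI_vector)
qed

lemma smooth_upto_cong:
  assumes "open I" "\<And>s. s \<in> I \<Longrightarrow> f s = g s" "smooth_upto n I f"
  shows "smooth_upto n I g"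
  using assms(2,3)
proof (induction n arbitrary: f g)
  case 0
  then show ?case
    using differentiable_cong_open[OF assms(1), of f g] by (simp add: smooth_upto_0)
next
  case (Suc n)
  have "smooth_upto n I (vderiv g)"
  proof (rule Suc.IH)
    show "vderiv f s = vderiv g s" if "s \<in> I" for s
      using vderiv_cong[OF assms(1) Suc.prems(1) that] .
    show "smooth_upto n I (vderiv f)" using Suc.prems(2) by (simp add: smooth_upto_Suc)
  qed
  moreover have "g differentiable (at s)" if "s \<in> I" for s
    using Suc.prems(2) that
    by (intro differentiable_cong_open[OF assms(1) Suc.prems(1) that]) (simp_all add: smooth_upto_Suc)
  ultimately show ?case by (simp add: smooth_upto_Suc)
qed

text \<open>The form in which differentiability is established below: an explicit derivative is usually
  known only on \<open>I\<close>, where it agrees with \<open>vderiv f\<close>.\<close>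

lemma smooth_upto_SucI:
  assumes "open I" "\<And>s. s \<in> I \<Longrightarrow> (f has_vector_derivative f' s) (at s)" "smooth_upto n I f'"
  shows "smooth_upto (Suc n) I f"
proof -
  have "smooth_upto n I (vderiv f)"
    by (rule smooth_upto_cong[OF assms(1) _ assms(3)]) (rule vderivI[OF assms(2), symmetric])
  with assms(2) show ?thesis by (auto simp: smooth_upto_Suc intro: differentiableI_vector)
qed

lemma smooth_upto_const: "open I \<Longrightarrow> smooth_upto n I (\<lambda>s. c)"
proof (induction n arbitrary: c)
  case (Suc n)
  then show ?case by (intro smooth_upto_SucI[where f' = "\<lambda>s. 0"]) auto
qed (simp add: smooth_upto_0)

lemma smooth_upto_add:
  assumes "open I" "smooth_upto n I f" "smooth_upto n I g"
  shows "smooth_upto n I (\<lambda>s. f s + g s)"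
  using assms(2,3)
proof (induction n arbitrary: f g)
  case (Suc n)
  then show ?case
    by (intro smooth_upto_SucI[where f' = "\<lambda>s. vderiv f s + vderiv g s"] assms)
      (auto simp: smooth_upto_Suc intro!: has_vector_derivative_add has_vderiv)
qed (simp add: smooth_upto_0)

lemma smooth_upto_bilinear:
  assumes "bounded_bilinear pr" "open I" "smooth_upto n I f" "smooth_upto n I g"
  shows "smooth_upto n I (\<lambda>s. pr (f s) (g s))"
  using assms(3,4)
proof (induction n arbitrary: f g)
  case 0
  then show ?case
    unfolding smooth_upto_0
    by (blast intro: differentiableI_vector[OF bounded_bilinear.has_vector_derivative[OF assms(1)]]
        has_vderiv)
next
  case (Suc n)
  have "smooth_upto n I (\<lambda>s. pr (f s) (vderiv g s) + pr (vderiv f s) (g s))"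
    using Suc.prems smooth_upto_Suc_imp[OF Suc.prems(1)] smooth_upto_Suc_imp[OF Suc.prems(2)]
    by (intro smooth_upto_add assms Suc.IH) (auto simp: smooth_upto_Suc)
  then show ?case using Suc.prems
    by (intro smooth_upto_SucI[OF assms(2)])
      (auto simp: smooth_upto_Suc
        intro!: bounded_bilinear.has_vector_derivative[OF assms(1)] has_vderiv)
qed

lemma smooth_upto_compose:
  fixes g :: "real \<Rightarrow> real"
  assumes "open I" "open L" "g ` L \<subseteq> I" "smooth_upto n I f" "smooth_upto n L g"
  shows "smooth_upto n L (\<lambda>t. f (g t))"
  using assms(4,5)
proof (induction n arbitrary: f)
  case 0
  have "(\<lambda>t. f (g t)) differentiable (at t)" if "t \<in> L" for t
    using that assms(3) 0 vector_diff_chain_at[OF has_vderiv[of g t] has_vderiv[of f "g t"]]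
    by (auto simp: smooth_upto_0 o_def intro: differentiableI_vector)
  then show ?case by (simp add: smooth_upto_0)
next
  case (Suc n)
  have d: "((\<lambda>t. f (g t)) has_vector_derivative (vderiv g t *\<^sub>R vderiv f (g t))) (at t)"
    if "t \<in> L" for t
    using that assms(3) Suc.prems vector_diff_chain_at[OF has_vderiv[of g t] has_vderiv[of f "g t"]]
    by (auto simp: smooth_upto_Suc o_def)
  have "smooth_upto n L (\<lambda>t. vderiv g t *\<^sub>R vderiv f (g t))"
    using Suc smooth_upto_Suc_imp[of n L g]
    by (intro smooth_upto_bilinear[OF bounded_bilinear_scaleR] assms) (auto simp: smooth_upto_Suc)
  with d show ?case by (intro smooth_upto_SucI[OF assms(2)])
qed

lemma smooth_upto_inverse:
  fixes f :: "real \<Rightarrow> real"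
  assumes "open I" "\<And>s. s \<in> I \<Longrightarrow> f s \<noteq> 0" "smooth_upto n I f"
  shows "smooth_upto n I (\<lambda>s. inverse (f s))"
  using assms(3)
proof (induction n)
  case 0
  then show ?case using assms(2) by (auto simp: smooth_upto_0)
next
  case (Suc n)
  then have inv: "smooth_upto n I (\<lambda>s. inverse (f s))" by (blast intro: smooth_upto_Suc_imp)
  have d: "((\<lambda>s. inverse (f s)) has_vector_derivative
        (- 1) * (vderiv f s * (inverse (f s) * inverse (f s)))) (at s)" if "s \<in> I" for s
  proof -
    have "(f has_real_derivative vderiv f s) (at s)"
      using has_vderiv[of f s] smooth_upto_differentiable[OF Suc.prems that]
      by (simp add: has_real_derivative_iff_has_vector_derivative)
    from DERIV_inverse'[OF this assms(2)[OF that]] show ?thesis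
      by (simp add: has_real_derivative_iff_has_vector_derivative[symmetric] ac_simps)
  qed
  have "smooth_upto n I (\<lambda>s. (- 1) * (vderiv f s * (inverse (f s) * inverse (f s))))"
    using Suc.prems
    by (intro smooth_upto_bilinear[OF bounded_bilinear_mult] smooth_upto_const assms inv)
      (auto simp: smooth_upto_Suc)
  with d show ?case by (intro smooth_upto_SucI[OF assms(1)])
qed

lemma smooth_upto_sqrt:
  fixes f :: "real \<Rightarrow> real"
  assumes "open I" "\<And>s. s \<in> I \<Longrightarrow> f s > 0" "smooth_upto n I f"
  shows "smooth_upto n I (\<lambda>s. sqrt (f s))"
proof -
  have d: "((\<lambda>s. sqrt (f s)) has_vector_derivative
        (1 / 2) * (vderiv f s * inverse (sqrt (f s)))) (at s)"
    if "s \<in> I" "f differentiable (at s)" for s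
  proof -
    have "(f has_real_derivative vderiv f s) (at s)"
      using has_vderiv[OF that(2)]
      by (simp add: has_real_derivative_iff_has_vector_derivative)
    from DERIV_chain2[OF DERIV_real_sqrt[OF assms(2)[OF that(1)]] this] show ?thesis
      by (simp add: has_real_derivative_iff_has_vector_derivative[symmetric] field_simps)
  qed
  show ?thesis
    using assms(3)
  proof (induction n)
    case 0
    then show ?case using d unfolding smooth_upto_0 by (blast intro: differentiableI_vector)
  next
    case (Suc n)
    then have sq: "smooth_upto n I (\<lambda>s. sqrt (f s))" by (blast intro: smooth_upto_Suc_imp)
    have "smooth_upto n I (\<lambda>s. (1 / 2) * (vderiv f s * inverse (sqrt (f s))))"
      using Suc.prems assms(2)
      by (intro smooth_upto_bilinear[OF bounded_bilinear_mult] smooth_upto_const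
          smooth_upto_inverse assms(1) sq)
        (auto simp: smooth_upto_Suc less_imp_neq[symmetric])
    moreover have "\<forall>s\<in>I. f differentiable (at s)" using Suc.prems by (simp add: smooth_upto_Suc)
    ultimately show ?case using d by (intro smooth_upto_SucI[OF assms(1)]) auto
  qed
qed

lemma smooth_on_differentiable: "smooth_on I f \<Longrightarrow> s \<in> I \<Longrightarrow> f differentiable (at s)"
  unfolding smooth_on_iff_smooth_upto by (blast intro: smooth_upto_differentiable)

lemma smooth_on_has_vderiv:
  "smooth_on I f \<Longrightarrow> s \<in> I \<Longrightarrow> (f has_vector_derivative vderiv f s) (at s)"
  by (simp add: has_vderiv smooth_on_differentiable)

lemma smooth_on_has_real_derivative:
  fixes f :: "real \<Rightarrow> real"
  shows "smooth_on I f \<Longrightarrow> s \<in> I \<Longrightarrow> (f has_real_derivative vderiv f s) (at s)"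
  by (simp add: smooth_on_has_vderiv has_real_derivative_iff_has_vector_derivative)

lemma smooth_on_vderiv: "smooth_on I f \<Longrightarrow> smooth_on I (vderiv f)"
  unfolding smooth_on_iff_smooth_upto using smooth_upto_Suc[of _ I f] by simp

lemma smooth_on_subset: "smooth_on I f \<Longrightarrow> J \<subseteq> I \<Longrightarrow> smooth_on J f"
  unfolding smooth_on_def by blast

lemma smooth_on_continuous: "smooth_on I f \<Longrightarrow> continuous_on I f"
  by (rule continuous_on_vector_derivative[OF has_vector_derivative_at_within[OF smooth_on_has_vderiv]])

lemma smooth_on_cong:
  "open I \<Longrightarrow> smooth_on I f \<Longrightarrow> (\<And>s. s \<in> I \<Longrightarrow> f s = g s) \<Longrightarrow> smooth_on I g"
  unfolding smooth_on_iff_smooth_upto using smooth_upto_cong[of I f g] by simp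

lemma smooth_on_const: "open I \<Longrightarrow> smooth_on I (\<lambda>s. c)"
  by (simp add: smooth_on_iff_smooth_upto smooth_upto_const)

lemma smooth_on_add:
  "open I \<Longrightarrow> smooth_on I f \<Longrightarrow> smooth_on I g \<Longrightarrow> smooth_on I (\<lambda>s. f s + g s)"
  by (simp add: smooth_on_iff_smooth_upto smooth_upto_add)

lemma smooth_on_bilinear:
  "bounded_bilinear pr \<Longrightarrow> open I \<Longrightarrow> smooth_on I f \<Longrightarrow> smooth_on I g \<Longrightarrow>
    smooth_on I (\<lambda>s. pr (f s) (g s))"
  by (simp add: smooth_on_iff_smooth_upto smooth_upto_bilinear)

lemmas smooth_on_scaleR = smooth_on_bilinear[OF bounded_bilinear_scaleR]
lemmas smooth_on_mult = smooth_on_bilinear[OF bounded_bilinear_mult]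
lemmas smooth_on_inner = smooth_on_bilinear[OF bounded_bilinear_inner]
lemmas bounded_bilinear_cross3 = bilinear_cross[unfolded bilinear_conv_bounded_bilinear]
lemmas smooth_on_cross = smooth_on_bilinear[OF bounded_bilinear_cross3]

lemma smooth_on_compose:
  fixes g :: "real \<Rightarrow> real"
  shows "open I \<Longrightarrow> open L \<Longrightarrow> g ` L \<subseteq> I \<Longrightarrow> smooth_on I f \<Longrightarrow> smooth_on L g \<Longrightarrow>
    smooth_on L (\<lambda>t. f (g t))"
  by (simp add: smooth_on_iff_smooth_upto smooth_upto_compose)

lemma smooth_on_inverse:
  fixes f :: "real \<Rightarrow> real"
  shows "open I \<Longrightarrow> smooth_on I f \<Longrightarrow> (\<And>s. s \<in> I \<Longrightarrow> f s \<noteq> 0) \<Longrightarrow> smooth_on I (\<lambda>s. inverse (f s))"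
  by (simp add: smooth_on_iff_smooth_upto smooth_upto_inverse)

lemma smooth_on_sqrt:
  fixes f :: "real \<Rightarrow> real"
  shows "open I \<Longrightarrow> smooth_on I f \<Longrightarrow> (\<And>s. s \<in> I \<Longrightarrow> f s > 0) \<Longrightarrow> smooth_on I (\<lambda>s. sqrt (f s))"
  by (simp add: smooth_on_iff_smooth_upto smooth_upto_sqrt)

text \<open>A nonvanishing derivative makes \<open>u\<close> injective on the interval by Rolle's theorem, so its image
  is open and the inverse is differentiable. Smoothness then bootstraps from \<open>w' = 1 / (u' \<circ> w)\<close>:
  if \<open>w\<close> has \<open>n\<close> derivatives, so has \<open>w'\<close>.\<close>

lemma smooth_inverse_function:
  fixes u :: "real \<Rightarrow> real"
  assumes J: "open_interval J" and u: "smooth_on J u"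
    and nz: "\<And>s. s \<in> J \<Longrightarrow> vderiv u s \<noteq> 0"
  obtains w where "open_interval (u ` J)" "smooth_on (u ` J) w"
    "\<And>s. s \<in> J \<Longrightarrow> w (u s) = s"
    "\<And>s. s \<in> J \<Longrightarrow> (w has_vector_derivative inverse (vderiv u s)) (at (u s))"
proof -
  have oJ: "open J" and iJ: "is_interval J" and neJ: "J \<noteq> {}"
    using J by (auto simp: open_interval_def)
  note du = smooth_on_has_real_derivative[OF u]
  have cont: "continuous_on J u" using u by (rule smooth_on_continuous)
  have rolle: "u a \<noteq> u b" if "a \<in> J" "b \<in> J" "a < b" for a b
  proof
    assume eq: "u a = u b"
    have sub: "{a..b} \<subseteq> J" using that(1,2) mem_is_interval_1_I[OF iJ] by (meson atLeastAtMost_iff subsetI)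
    have "\<exists>z>a. z < b \<and> (\<lambda>h. h * vderiv u z) = (\<lambda>v. 0)"
    proof (rule Rolle_deriv[OF \<open>a < b\<close> eq])
      show "continuous_on {a..b} u" by (rule continuous_on_subset[OF cont sub])
      show "(u has_derivative (\<lambda>h. h * vderiv u x)) (at x)" if "a < x" "x < b" for x
        using du[of x] that sub
        by (auto simp: has_field_derivative_def subset_eq mult.commute[of _ "vderiv u x"])
    qed
    then obtain z where "a < z" "z < b" "(\<lambda>h. h * vderiv u z) = (\<lambda>v. 0)" by blast
    with fun_cong[of "\<lambda>h. h * vderiv u z" "\<lambda>v. 0" 1] nz[of z] sub show False
      by (auto simp: subset_eq)
  qed
  have inj: "inj_on u J"
    by (rule linorder_inj_onI') (use rolle in auto)
  define w where "w = the_inv_into J u"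
  have wu: "w (u s) = s" if "s \<in> J" for s
    unfolding w_def by (rule the_inv_into_f_f[OF inj that])
  have oL: "open (u ` J)"
    using injective_eq_1d_open_map_UNIV[OF cont iJ] inj oJ by (metis subset_refl)
  have iL: "is_interval (u ` J)"
    using iJ cont connected_continuous_image is_interval_connected_1 by blast
  have dw: "(w has_vector_derivative inverse (vderiv u s)) (at (u s))" if "s \<in> J" for s
    unfolding has_vector_derivative_def
    by (rule has_derivative_inverse_strong[OF oJ that cont wu
          du[OF that, unfolded has_field_derivative_def]]) (use nz[OF that] in auto)
  have "smooth_upto n (u ` J) w" for n
  proof (induction n)
    case 0
    show ?case using dw unfolding smooth_upto_0 by (auto intro: differentiableI_vector)
  next
    case (Suc n)
    have "smooth_upto n (u ` J) (\<lambda>t. inverse (vderiv u (w t)))"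
    proof (rule smooth_upto_inverse[OF oL])
      have du': "smooth_upto n J (vderiv u)"
        using smooth_on_vderiv[OF u] by (simp add: smooth_on_iff_smooth_upto)
      show "smooth_upto n (u ` J) (\<lambda>t. vderiv u (w t))"
        by (rule smooth_upto_compose[OF oJ oL _ du' Suc]) (use wu in auto)
    qed (use wu nz in auto)
    then show ?case
      using dw wu by (intro smooth_upto_SucI[OF oL]) auto
  qed
  then have "smooth_on (u ` J) w" by (simp add: smooth_on_iff_smooth_upto)
  moreover have "open_interval (u ` J)" using oL iL neJ by (simp add: open_interval_def)
  ultimately show ?thesis using that wu dw by blast
qed


section \<open>The Frenet apparatus\<close>

lemma has_vector_derivative_inner:
  assumes "(f has_vector_derivative f') (at s)" "(g has_vector_derivative g') (at s)"
  shows "((\<lambda>s. f s \<bullet> g s) has_vector_derivative (f s \<bullet> g' + f' \<bullet> g s)) (at s)"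
  using bounded_bilinear.has_vector_derivative[OF bounded_bilinear_inner assms] .

lemma vector_derivative_of_locally_constant:
  fixes f :: "real \<Rightarrow> 'a::real_normed_vector"
  assumes "open I" "s \<in> I" "\<And>s. s \<in> I \<Longrightarrow> f s = c" "(f has_vector_derivative f') (at s)"
  shows "f' = 0"
proof -
  have "((\<lambda>_. c) has_vector_derivative f') (at s)"
    using has_vector_derivative_cong_open[where f = f and g = "\<lambda>_. c", OF assms(1) assms(3) assms(2)]
      assms(4) by simp
  then show ?thesis
    using vector_derivative_unique_at[OF has_vector_derivative_const] by metis
qed

lemma constant_if_vector_derivative_0:
  fixes f :: "real \<Rightarrow> 'a::real_normed_vector"
  assumes "open_interval I" "\<And>s. s \<in> I \<Longrightarrow> (f has_vector_derivative 0) (at s)"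
  obtains c where "\<And>s. s \<in> I \<Longrightarrow> f s = c"
proof (rule has_vector_derivative_zero_constant[of I f])
  show "convex I" using assms(1) by (simp add: open_interval_def is_interval_convex)
  show "(f has_vector_derivative 0) (at s within I)" if "s \<in> I" for s
    using assms(2)[OF that] by (rule has_vector_derivative_at_within)
qed (use that in blast)

lemma cross_orthonormal:
  fixes t n :: "real^3"
  assumes "norm t = 1" "norm n = 1" "t \<bullet> n = 0"
  shows "norm (t \<times> n) = 1" "t \<times> (t \<times> n) = - n"
proof -
  have "(norm (t \<times> n))\<^sup>2 = 1" using assms by (simp add: norm_cross)
  then show "norm (t \<times> n) = 1" using norm_ge_zero[of "t \<times> n"]
    by (auto simp: power2_eq_1_iff simp del: norm_ge_zero)
  have "t \<bullet> t = 1" "n \<bullet> n = 1" using assms by (simp_all add: norm_eq_1)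
  then show "t \<times> (t \<times> n) = - n"
    using assms by (simp add: Lagrange)
qed

text \<open>The difference \<open>y\<close> of both sides is orthogonal to \<open>b = t \<times> n\<close>, and \<open>y \<times> b\<close> is a combination of
  \<open>t\<close> and \<open>n\<close> with coefficients \<open>y \<bullet> n\<close> and \<open>- (y \<bullet> t)\<close>, which vanish. A vector that is both
  orthogonal and parallel to a unit vector is zero.\<close>

lemma orthonormal_expansion:
  fixes t n :: "real^3"
  assumes "norm t = 1" "norm n = 1" "t \<bullet> n = 0"
  shows "x = (x \<bullet> t) *\<^sub>R t + (x \<bullet> n) *\<^sub>R n + (x \<bullet> (t \<times> n)) *\<^sub>R (t \<times> n)"
proof -
  define b where "b = t \<times> n"
  define y where "y = x - ((x \<bullet> t) *\<^sub>R t + (x \<bullet> n) *\<^sub>R n + (x \<bullet> b) *\<^sub>R b)"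
  have nb: "norm b = 1" unfolding b_def by (rule cross_orthonormal[OF assms])
  have sq: "t \<bullet> t = 1" "n \<bullet> n = 1" "b \<bullet> b = 1"
    using assms nb by (simp_all add: norm_eq_1)
  have orth: "t \<bullet> b = 0" "b \<bullet> t = 0" "n \<bullet> b = 0" "b \<bullet> n = 0" "n \<bullet> t = 0"
    using assms(3) by (simp_all add: b_def dot_cross_self inner_commute)
  have y0: "y \<bullet> t = 0" "y \<bullet> n = 0" "y \<bullet> b = 0"
    using sq orth assms(3) by (simp_all add: y_def inner_diff_left inner_add_left)
  have "y \<times> b = 0"
    using y0 by (simp add: b_def Lagrange)
  then have "(norm y)\<^sup>2 = 0"
    using norm_cross[of y b] y0 nb by simp
  then show ?thesis by (simp add: y_def b_def)
qed

locale frenet =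
  fixes \<gamma> :: "real \<Rightarrow> real^3" and I :: "real set"
  assumes frenet_curve: "frenet_curve \<gamma> I"
begin

abbreviation "T \<equiv> frenet_T \<gamma>"
abbreviation "N \<equiv> frenet_N \<gamma>"
abbreviation "B \<equiv> frenet_B \<gamma>"
abbreviation "\<kappa> \<equiv> curvature \<gamma>"
abbreviation "\<tau> \<equiv> torsion \<gamma>"
abbreviation "\<rho> \<equiv> torsion_ratio \<gamma>"
abbreviation "\<rho>' \<equiv> vderiv \<rho>"
abbreviation "\<rho>'' \<equiv> vderiv (vderiv \<rho>)"

lemma interval: "open_interval I" and open_I: "open I" and smooth_curve: "smooth_on I \<gamma>"
  and norm_T: "s \<in> I \<Longrightarrow> norm (T s) = 1" and curvature_pos: "s \<in> I \<Longrightarrow> \<kappa> s > 0"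
  using frenet_curve by (auto simp: frenet_curve_def open_interval_def)

lemma smooth_T: "smooth_on I T"
  unfolding frenet_T_def by (rule smooth_on_vderiv[OF smooth_curve])

lemma smooth_curvature: "smooth_on I \<kappa>"
proof -
  have eq: "\<kappa> s = sqrt (vderiv T s \<bullet> vderiv T s)" for s
    by (simp add: curvature_def norm_eq_sqrt_inner)
  have "smooth_on I (\<lambda>s. sqrt (vderiv T s \<bullet> vderiv T s))"
    using curvature_pos
    by (intro smooth_on_sqrt open_I smooth_on_inner smooth_on_vderiv smooth_T)
      (metis eq real_sqrt_gt_0_iff)
  then show ?thesis by (rule smooth_on_cong[OF open_I]) (simp add: eq)
qed

lemma curvature_nz: "s \<in> I \<Longrightarrow> \<kappa> s \<noteq> 0"
  using curvature_pos by fastforce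

lemma smooth_N: "smooth_on I N"
proof -
  have "smooth_on I (\<lambda>s. inverse (\<kappa> s) *\<^sub>R vderiv T s)"
    by (intro smooth_on_scaleR open_I smooth_on_inverse smooth_curvature smooth_on_vderiv smooth_T
        curvature_nz)
  then show ?thesis by (rule smooth_on_cong[OF open_I]) (simp add: frenet_N_def)
qed

lemma smooth_B: "smooth_on I B"
proof -
  have "smooth_on I (\<lambda>s. T s \<times> N s)"
    by (intro smooth_on_cross open_I smooth_T smooth_N)
  then show ?thesis by (rule smooth_on_cong[OF open_I]) (simp add: frenet_B_def)
qed

lemma smooth_torsion_ratio: "smooth_on I \<rho>"
proof -
  have "smooth_on I (\<lambda>s. (vderiv N s \<bullet> B s) * inverse (\<kappa> s))"
    by (intro smooth_on_mult smooth_on_inner open_I smooth_on_inverse smooth_curvature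
        smooth_on_vderiv smooth_N smooth_B curvature_nz)
  then show ?thesis
    by (rule smooth_on_cong[OF open_I]) (simp add: torsion_ratio_def torsion_def divide_inverse)
qed

lemma deriv_T: "s \<in> I \<Longrightarrow> (T has_vector_derivative \<kappa> s *\<^sub>R N s) (at s)"
  using smooth_on_has_vderiv[OF smooth_T, of s] curvature_nz[of s] by (simp add: frenet_N_def)

lemma norm_N: "s \<in> I \<Longrightarrow> norm (N s) = 1"
  using curvature_pos[of s] by (simp add: frenet_N_def) (simp add: curvature_def)

lemma T_inner_N: assumes "s \<in> I" shows "T s \<bullet> N s = 0"
proof -
  have "T s \<bullet> \<kappa> s *\<^sub>R N s + \<kappa> s *\<^sub>R N s \<bullet> T s = 0"
    using norm_T
    by (intro vector_derivative_of_locally_constant[OF open_I assms _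
          has_vector_derivative_inner[OF deriv_T[OF assms] deriv_T[OF assms]], of 1])
      (simp add: norm_eq_1)
  then show ?thesis using curvature_nz[OF assms] by (simp add: inner_commute)
qed

lemma frame_inner:
  assumes "s \<in> I"
  shows "T s \<bullet> T s = 1" "N s \<bullet> N s = 1" "B s \<bullet> B s = 1"
    "T s \<bullet> N s = 0" "N s \<bullet> T s = 0" "T s \<bullet> B s = 0" "B s \<bullet> T s = 0" "N s \<bullet> B s = 0" "B s \<bullet> N s = 0"
  using norm_T[OF assms] norm_N[OF assms] T_inner_N[OF assms] cross_orthonormal(1)[of "T s" "N s"]
  by (simp_all add: frenet_B_def norm_eq_1 inner_commute dot_cross_self)

lemma frame_expansion:
  assumes "s \<in> I"
  shows "x = (x \<bullet> T s) *\<^sub>R T s + (x \<bullet> N s) *\<^sub>R N s + (x \<bullet> B s) *\<^sub>R B s"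
  unfolding frenet_B_def
  by (rule orthonormal_expansion[OF norm_T[OF assms] norm_N[OF assms] T_inner_N[OF assms]])

lemma deriv_N:
  assumes "s \<in> I"
  shows "(N has_vector_derivative (- \<kappa> s) *\<^sub>R T s + \<tau> s *\<^sub>R B s) (at s)"
proof -
  note dN = smooth_on_has_vderiv[OF smooth_N assms]
  have "N s \<bullet> vderiv N s + vderiv N s \<bullet> N s = 0"
    using frame_inner
    by (intro vector_derivative_of_locally_constant[OF open_I assms _
          has_vector_derivative_inner[OF dN dN], of 1]) simp
  then have NN: "vderiv N s \<bullet> N s = 0" by (simp add: inner_commute)
  have "N s \<bullet> \<kappa> s *\<^sub>R N s + vderiv N s \<bullet> T s = 0"
    using frame_inner
    by (intro vector_derivative_of_locally_constant[OF open_I assms _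
          has_vector_derivative_inner[OF dN deriv_T[OF assms]], of 0]) simp
  then have "vderiv N s \<bullet> T s = - \<kappa> s" using frame_inner[OF assms] by simp
  with NN have "vderiv N s = (- \<kappa> s) *\<^sub>R T s + \<tau> s *\<^sub>R B s"
    using frame_expansion[OF assms, of "vderiv N s"] by (simp add: torsion_def)
  with dN show ?thesis by simp
qed

lemma deriv_B:
  assumes "s \<in> I"
  shows "(B has_vector_derivative (- \<tau> s) *\<^sub>R N s) (at s)"
proof -
  have eq: "B = (\<lambda>s. T s \<times> N s)" by (simp add: frenet_B_def fun_eq_iff)
  have "T s \<times> ((- \<kappa> s) *\<^sub>R T s + \<tau> s *\<^sub>R B s) + (\<kappa> s *\<^sub>R N s) \<times> N s = (- \<tau> s) *\<^sub>R N s"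
    using cross_orthonormal(2)[OF norm_T[OF assms] norm_N[OF assms] T_inner_N[OF assms]]
    by (simp add: frenet_B_def Cross3.right_diff_distrib cross_add_right cross_mult_right cross_mult_left
        cross_minus_right scaleR_minus_left)
  with bounded_bilinear.has_vector_derivative[OF bounded_bilinear_cross3
      deriv_T[OF assms] deriv_N[OF assms]]
  show ?thesis unfolding eq by simp
qed

lemma torsion_eq: "s \<in> I \<Longrightarrow> \<tau> s = \<rho> s * \<kappa> s"
  using curvature_nz by (simp add: torsion_ratio_def)

lemma deriv_torsion_ratio: "s \<in> I \<Longrightarrow> deriv \<rho> s = \<rho>' s"
  by (rule DERIV_imp_deriv[OF smooth_on_has_real_derivative[OF smooth_torsion_ratio]])

lemma deriv_deriv_torsion_ratio: assumes "s \<in> I" shows "deriv (deriv \<rho>) s = \<rho>'' s"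
proof (rule DERIV_imp_deriv)
  have "(deriv \<rho> has_vector_derivative \<rho>'' s) (at s)"
    using has_vector_derivative_cong_open[where f = "deriv \<rho>" and g = \<rho>',
        OF open_I deriv_torsion_ratio assms]
      smooth_on_has_vderiv[OF smooth_on_vderiv[OF smooth_torsion_ratio] assms] by blast
  then show "(deriv \<rho> has_real_derivative \<rho>'' s) (at s)"
    by (simp add: has_real_derivative_iff_has_vector_derivative)
qed

section \<open>The rectifying developable\<close>

text \<open>The classical Darboux vector \<open>\<tau> T + \<kappa> B\<close> divided by \<open>\<kappa>\<close>. This scaling is the one for which
  the \<open>N\<close> components cancel in the derivative.\<close>

definition darboux :: "real \<Rightarrow> real^3" where
  "darboux s = \<rho> s *\<^sub>R T s + B s"

lemma deriv_darboux:
  assumes "s \<in> I"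
  shows "(darboux has_vector_derivative \<rho>' s *\<^sub>R T s) (at s)"
proof -
  have "((\<lambda>s. \<rho> s *\<^sub>R T s + B s) has_vector_derivative
      (\<rho> s *\<^sub>R (\<kappa> s *\<^sub>R N s) + \<rho>' s *\<^sub>R T s) + (- \<tau> s) *\<^sub>R N s) (at s)"
    by (intro has_vector_derivative_add has_vector_derivative_scaleR deriv_T deriv_B assms
        smooth_on_has_real_derivative[OF smooth_torsion_ratio])
  then show ?thesis using torsion_eq[OF assms] by (simp add: darboux_def[abs_def])
qed

lemma smooth_darboux: "smooth_on I darboux"
proof -
  have "smooth_on I (\<lambda>s. \<rho> s *\<^sub>R T s + B s)"
    by (intro smooth_on_add smooth_on_scaleR open_I smooth_torsion_ratio smooth_T smooth_B)
  then show ?thesis by (simp add: darboux_def[abs_def])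
qed

lemma darboux_inner:
  assumes "s \<in> I"
  shows "darboux s \<bullet> darboux s = 1 + (\<rho> s)\<^sup>2" "darboux s \<bullet> N s = 0" "T s \<bullet> darboux s = \<rho> s"
  using frame_inner[OF assms]
  by (simp_all add: darboux_def inner_add_left inner_add_right power2_eq_square)

text \<open>The edge of regression of the rectifying developable. On the ruling \<open>\<gamma> + h W\<close> the velocity
  is \<open>(1 + h \<rho>') T + h' W\<close>, which is tangent to the ruling exactly for \<open>h = - 1 / \<rho>'\<close>.\<close>

definition edge :: "real \<Rightarrow> real^3" where
  "edge s = \<gamma> s - inverse (\<rho>' s) *\<^sub>R darboux s"

lemma smooth_edge:
  assumes "\<And>s. s \<in> I \<Longrightarrow> \<rho>' s \<noteq> 0"
  shows "smooth_on I edge"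
proof -
  have "smooth_on I (\<lambda>s. \<gamma> s + (- 1) *\<^sub>R (inverse (\<rho>' s) *\<^sub>R darboux s))"
    by (intro smooth_on_add smooth_on_scaleR smooth_on_const smooth_on_inverse smooth_on_vderiv
        open_I smooth_torsion_ratio smooth_curve smooth_darboux assms)
  then show ?thesis by (simp add: edge_def[abs_def])
qed

lemma deriv_edge:
  assumes "s \<in> I" "\<rho>' s \<noteq> 0"
  shows "(edge has_vector_derivative (\<rho>'' s / (\<rho>' s)\<^sup>2) *\<^sub>R darboux s) (at s)"
proof -
  have d: "((\<lambda>s. inverse (\<rho>' s)) has_real_derivative - (\<rho>'' s / (\<rho>' s)\<^sup>2)) (at s)"
    using DERIV_inverse'[OF smooth_on_has_real_derivative[OF smooth_on_vderiv[OF
          smooth_torsion_ratio] assms(1)] assms(2)]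
    by (simp add: power2_eq_square divide_inverse ac_simps)
  have "(\<gamma> has_vector_derivative T s) (at s)"
    using smooth_on_has_vderiv[OF smooth_curve assms(1)] by (simp add: frenet_T_def)
  from has_vector_derivative_diff[OF this
      has_vector_derivative_scaleR[OF d deriv_darboux[OF assms(1)]]]
  show ?thesis using assms(2) by (simp add: edge_def[abs_def])
qed

text \<open>Lancret's theorem: for constant \<open>\<rho>\<close> the Darboux vector is constant and spans the axis.\<close>

lemma generalized_helix_if_constant_ratio:
  assumes "\<And>s. s \<in> I \<Longrightarrow> \<rho>' s = 0"
  shows "generalized_helix \<gamma> I"
proof -
  obtain w where w: "\<And>s. s \<in> I \<Longrightarrow> darboux s = w"
    using constant_if_vector_derivative_0[OF interval, of darboux] deriv_darboux assms by force
  obtain r where r: "\<And>s. s \<in> I \<Longrightarrow> \<rho> s = r"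
    using constant_if_vector_derivative_0[OF interval, of \<rho>]
      smooth_on_has_vderiv[OF smooth_torsion_ratio] assms by force
  obtain s0 where s0: "s0 \<in> I" using interval by (auto simp: open_interval_def)
  have "w \<bullet> w = 1 + r\<^sup>2" using darboux_inner(1)[OF s0] w r s0 by simp
  then have "w \<noteq> 0" by (metis add_nonneg_eq_0_iff inner_zero_left one_neq_zero zero_le_one zero_le_power2)
  then have "norm (w /\<^sub>R norm w) = 1" by simp
  moreover have "T s \<bullet> (w /\<^sub>R norm w) = inverse (norm w) * r" if "s \<in> I" for s
    using darboux_inner(3)[OF that] w r that by simp
  ultimately show ?thesis using frenet_curve unfolding generalized_helix_def by blast
qed

text \<open>The rectifying developable degenerates to a cone: its edge of regression is the vertex, and
  the vertex serves as origin.\<close>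

lemma rectifying_if_affine_ratio:
  assumes "\<And>s. s \<in> I \<Longrightarrow> \<rho>' s = c" "c \<noteq> 0"
  shows "rectifying_curve \<gamma> I"
proof -
  have "\<rho>'' s = 0" if "s \<in> I" for s
    using vector_derivative_of_locally_constant[OF open_I that assms(1)
        smooth_on_has_vderiv[OF smooth_on_vderiv[OF smooth_torsion_ratio] that]] by simp
  then have "(edge has_vector_derivative 0) (at s)" if "s \<in> I" for s
    using deriv_edge[OF that] assms that by simp
  then obtain p where p: "\<And>s. s \<in> I \<Longrightarrow> edge s = p"
    using constant_if_vector_derivative_0[OF interval, of edge] by blast
  have "\<gamma> s - p \<in> span {T s, B s}" if "s \<in> I" for s
  proof -
    have "\<gamma> s - p = inverse c *\<^sub>R (\<rho> s *\<^sub>R T s + B s)"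
      using p[OF that] assms(1)[OF that] by (auto simp: edge_def darboux_def)
    then show ?thesis by (simp add: span_add span_scale span_base)
  qed
  then show ?thesis using frenet_curve unfolding rectifying_curve_def by blast
qed

text \<open>At every point one of \<open>\<rho>'\<close> and \<open>\<rho>''\<close> vanishes, but which one may vary from point to point.
  The square \<open>\<rho>'\<^sup>2\<close> has derivative \<open>2 \<rho>' \<rho>'' = 0\<close> in either case, so \<open>\<rho>'\<close> vanishes everywhere or
  nowhere.\<close>

lemma constant_derivative_of_ratio:
  assumes "\<And>s. s \<in> I \<Longrightarrow> \<rho>' s = 0 \<or> \<rho>'' s = 0"
  obtains c where "\<And>s. s \<in> I \<Longrightarrow> \<rho>' s = c"
proof -
  note d2 = smooth_on_has_vderiv[OF smooth_on_vderiv[OF smooth_torsion_ratio]]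
  have "((\<lambda>s. \<rho>' s * \<rho>' s) has_vector_derivative 0) (at s)" if "s \<in> I" for s
    using has_vector_derivative_mult[OF d2[OF that] d2[OF that]] assms[OF that] by auto
  then obtain q where q: "\<And>s. s \<in> I \<Longrightarrow> \<rho>' s * \<rho>' s = q"
    using constant_if_vector_derivative_0[OF interval, of "\<lambda>s. \<rho>' s * \<rho>' s"] by blast
  show ?thesis
  proof (cases "q = 0")
    case True
    then show ?thesis using q that[of 0] by simp
  next
    case False
    then have "(\<rho>' has_vector_derivative 0) (at s)" if "s \<in> I" for s
      using d2[OF that] assms[OF that] q[OF that] by auto
    then show ?thesis using constant_if_vector_derivative_0[OF interval, of \<rho>'] that by blast
  qed
qed

lemma exists_regular_subinterval:
  assumes "\<not> generalized_helix \<gamma> I" "\<not> rectifying_curve \<gamma> I"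
  obtains K where "open_interval K" "K \<subseteq> I" "\<And>s. s \<in> K \<Longrightarrow> \<rho>' s \<noteq> 0" "\<And>s. s \<in> K \<Longrightarrow> \<rho>'' s \<noteq> 0"
proof -
  obtain s0 where s0: "s0 \<in> I" "\<rho>' s0 \<noteq> 0" "\<rho>'' s0 \<noteq> 0"
    using constant_derivative_of_ratio generalized_helix_if_constant_ratio
      rectifying_if_affine_ratio assms by metis
  have "continuous_on I (\<lambda>s. \<rho>' s * \<rho>'' s)"
    by (intro smooth_on_continuous smooth_on_mult open_I smooth_on_vderiv smooth_torsion_ratio)
  then have "open ((\<lambda>s. \<rho>' s * \<rho>'' s) -` (- {0}) \<inter> I)"
    using continuous_on_open_vimage[OF open_I] by blast
  then obtain e where e: "e > 0" "ball s0 e \<subseteq> (\<lambda>s. \<rho>' s * \<rho>'' s) -` (- {0}) \<inter> I"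
    using s0 by (force simp: open_contains_ball)
  have "open_interval (ball s0 e)"
    using e(1) by (simp add: open_interval_def is_interval_ball_real)
  with e(2) show ?thesis by (intro that[of "ball s0 e"]) auto
qed

end


section \<open>Curves with prescribed tangent direction\<close>

text \<open>If \<open>A' = u' E\<close> with \<open>E\<close> of length one, then \<open>u\<close> is an arclength of \<open>A\<close> up to orientation, and
  \<open>A \<circ> u\<inverse>\<close> has tangent exactly \<open>E\<close>, whatever the sign of \<open>u'\<close>. Its curvature is positive because
  \<open>E' \<noteq> 0\<close>.\<close>

lemma unit_speed_reparametrization:
  fixes A E E' :: "real \<Rightarrow> real^3" and u :: "real \<Rightarrow> real"
  assumes I: "open_interval I" and A: "smooth_on I A" and u: "smooth_on I u"
    and u': "\<And>s. s \<in> I \<Longrightarrow> vderiv u s \<noteq> 0"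
    and dA: "\<And>s. s \<in> I \<Longrightarrow> (A has_vector_derivative vderiv u s *\<^sub>R E s) (at s)"
    and norm_E: "\<And>s. s \<in> I \<Longrightarrow> norm (E s) = 1"
    and dE: "\<And>s. s \<in> I \<Longrightarrow> (E has_vector_derivative E' s) (at s)"
    and E': "\<And>s. s \<in> I \<Longrightarrow> E' s \<noteq> 0"
  obtains \<alpha> where "frenet_curve \<alpha> (u ` I)"
    "\<And>s. s \<in> I \<Longrightarrow> \<alpha> (u s) = A s"
    "\<And>s. s \<in> I \<Longrightarrow> frenet_T \<alpha> (u s) = E s"
    "\<And>s. s \<in> I \<Longrightarrow> vderiv (frenet_T \<alpha>) (u s) = inverse (vderiv u s) *\<^sub>R E' s"
proof -
  obtain w where L: "open_interval (u ` I)" and w: "smooth_on (u ` I) w"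
    and wu: "\<And>s. s \<in> I \<Longrightarrow> w (u s) = s"
    and dw: "\<And>s. s \<in> I \<Longrightarrow> (w has_vector_derivative inverse (vderiv u s)) (at (u s))"
    using smooth_inverse_function[OF I u u'] by blast
  have oI: "open I" and oL: "open (u ` I)" using I L by (auto simp: open_interval_def)
  define \<alpha> where "\<alpha> = (\<lambda>t. A (w t))"
  have \<alpha>: "\<alpha> (u s) = A s" if "s \<in> I" for s
    using wu[OF that] by (simp add: \<alpha>_def)
  have T: "frenet_T \<alpha> (u s) = E s" if "s \<in> I" for s
    using vector_diff_chain_at[OF dw[OF that], of A "vderiv u s *\<^sub>R E s"]
      dA[OF that] wu[OF that] u'[OF that]
    unfolding frenet_T_def \<alpha>_def by (intro vderivI) (simp add: o_def)
  have "vderiv (frenet_T \<alpha>) (u s) = vderiv (\<lambda>t. E (w t)) (u s)" if "s \<in> I" for s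
    by (rule vderiv_cong[OF oL]) (use T wu that in auto)
  moreover have "vderiv (\<lambda>t. E (w t)) (u s) = inverse (vderiv u s) *\<^sub>R E' s" if "s \<in> I" for s
    using vector_diff_chain_at[OF dw[OF that], of E "E' s"] dE[OF that] wu[OF that]
    by (intro vderivI) (simp add: o_def)
  ultimately have dT: "vderiv (frenet_T \<alpha>) (u s) = inverse (vderiv u s) *\<^sub>R E' s"
    if "s \<in> I" for s using that by simp
  have "smooth_on (u ` I) \<alpha>"
    unfolding \<alpha>_def by (rule smooth_on_compose[OF oI oL _ A w]) (use wu in auto)
  moreover have "norm (frenet_T \<alpha> t) = 1 \<and> curvature \<alpha> t > 0" if "t \<in> u ` I" for t
    using that T dT norm_E E' u' by (auto simp: curvature_def)
  ultimately have "frenet_curve \<alpha> (u ` I)"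
    using L by (simp add: frenet_curve_def)
  then show ?thesis using \<alpha> T dT by (rule that)
qed

section \<open>Concircular helices as geodesics\<close>

lemma tangent_surface_partials:
  assumes "\<alpha> differentiable (at u)" "frenet_T \<alpha> differentiable (at u)"
  shows "vderiv (\<lambda>x. tangent_surface \<alpha> x v) u = (v - u) *\<^sub>R vderiv (frenet_T \<alpha>) u"
    and "vderiv (\<lambda>y. tangent_surface \<alpha> u y) v = frenet_T \<alpha> u"
proof -
  have d: "((\<lambda>x. v - x) has_real_derivative - 1) (at u)"
    by (auto intro!: derivative_eq_intros)
  have "(\<alpha> has_vector_derivative frenet_T \<alpha> u) (at u)"
    using has_vderiv[OF assms(1)] by (simp add: frenet_T_def)
  from has_vector_derivative_add[OF this has_vector_derivative_scaleR[OF d has_vderiv[OF assms(2)]]]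
  show "vderiv (\<lambda>x. tangent_surface \<alpha> x v) u = (v - u) *\<^sub>R vderiv (frenet_T \<alpha>) u"
    by (intro vderivI) (simp add: tangent_surface_def)
  have e: "((\<lambda>y. y - u) has_real_derivative 1) (at v)"
    by (auto intro!: derivative_eq_intros)
  show "vderiv (\<lambda>y. tangent_surface \<alpha> u y) v = frenet_T \<alpha> u"
    unfolding tangent_surface_def
    using has_vector_derivative_add[OF has_vector_derivative_const
        has_vector_derivative_scaleR[OF e has_vector_derivative_const[of "frenet_T \<alpha> u"]], of "\<alpha> u"]
    by (intro vderivI) simp
qed

text \<open>The edge of regression is built in place, so the rigid motion is the identity.\<close>

lemma congruent_if_geodesic:
  assumes "geodesic_of_surface (tangent_surface \<alpha>) (tangent_surface_dom L) \<gamma> J"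
  shows "congruent_to_tangent_surface_geodesic \<gamma> J \<alpha> L"
proof -
  have "rigid_motion (\<lambda>x. x)"
    unfolding rigid_motion_def
    by (rule exI[of _ "mat 1"], rule exI[of _ 0])
      (simp add: rotation_matrix_def orthogonal_matrix_id)
  then show ?thesis
    using assms unfolding congruent_to_tangent_surface_geodesic_def
    by (intro exI[of _ "\<lambda>x. x"]) (simp add: o_def)
qed

context frenet
begin

text \<open>Differentiating \<open>N \<bullet> (\<gamma> - p) = c\<close> gives \<open>- \<kappa> (T \<bullet> (\<gamma> - p)) + \<tau> (B \<bullet> (\<gamma> - p)) = 0\<close>; divide by
  \<open>- \<kappa>\<close>.\<close>

lemma concircular_position:
  assumes "\<And>s. s \<in> I \<Longrightarrow> N s \<bullet> (\<gamma> s - p) = c" "s \<in> I"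
  shows "(\<gamma> s - p) \<bullet> (T s - \<rho> s *\<^sub>R B s) = 0"
proof -
  have dY: "((\<lambda>s. \<gamma> s - p) has_vector_derivative T s) (at s)"
    using smooth_on_has_vderiv[OF smooth_curve assms(2)]
    by (simp add: frenet_T_def has_vector_derivative_diff_const)
  have "N s \<bullet> T s + ((- \<kappa> s) *\<^sub>R T s + \<tau> s *\<^sub>R B s) \<bullet> (\<gamma> s - p) = 0"
    by (rule vector_derivative_of_locally_constant[OF open_I assms(2,1)
          has_vector_derivative_inner[OF deriv_N[OF assms(2)] dY]])
  then have "\<kappa> s * (y \<bullet> (T s - \<rho> s *\<^sub>R B s)) = 0" if "y = \<gamma> s - p" for y
    unfolding that[symmetric] using frame_inner[OF assms(2)] torsion_eq[OF assms(2)]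
    by (auto simp: inner_add_left inner_diff_right inner_commute[of y] algebra_simps)
  then show ?thesis using curvature_nz[OF assms(2)] by simp
qed

definition unit_darboux :: "real \<Rightarrow> real^3" where
  "unit_darboux s = inverse (sqrt (1 + (\<rho> s)\<^sup>2)) *\<^sub>R darboux s"

lemma darboux_norm_pos: "sqrt (1 + (\<rho> s)\<^sup>2) > 0"
  by (simp add: add_pos_nonneg)

lemma norm_unit_darboux: assumes "s \<in> I" shows "norm (unit_darboux s) = 1"
proof -
  have "norm (darboux s) = sqrt (1 + (\<rho> s)\<^sup>2)"
    by (simp only: norm_eq_sqrt_inner darboux_inner(1)[OF assms])
  then show ?thesis using darboux_norm_pos[of s] by (simp add: unit_darboux_def)
qed

lemma smooth_darboux_norm: "smooth_on I (\<lambda>s. sqrt (1 + (\<rho> s)\<^sup>2))"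
proof -
  have "smooth_on I (\<lambda>s. sqrt (1 + \<rho> s * \<rho> s))"
    by (intro smooth_on_sqrt smooth_on_add smooth_on_const smooth_on_mult open_I
        smooth_torsion_ratio) (simp add: add_pos_nonneg)
  then show ?thesis by (simp add: power2_eq_square)
qed

lemma smooth_unit_darboux: "smooth_on I unit_darboux"
proof -
  have "smooth_on I (\<lambda>s. inverse (sqrt (1 + (\<rho> s)\<^sup>2)) *\<^sub>R darboux s)"
    using darboux_norm_pos
    by (intro smooth_on_scaleR smooth_on_inverse open_I smooth_darboux_norm smooth_darboux)
      (simp add: less_imp_neq[symmetric])
  then show ?thesis by (simp add: unit_darboux_def[abs_def])
qed

text \<open>The frame contributes only \<open>N\<close> components, which cancel, so this is as for a fixed \<open>T\<close>, \<open>B\<close>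
  plane: the unit vector along \<open>\<rho> T + B\<close> rotates towards the
  perpendicular direction \<open>T - \<rho> B\<close>.\<close>

lemma deriv_unit_darboux:
  assumes "s \<in> I"
  shows "(unit_darboux has_vector_derivative
    (\<rho>' s * inverse (sqrt (1 + (\<rho> s)\<^sup>2)) ^ 3) *\<^sub>R (T s - \<rho> s *\<^sub>R B s)) (at s)"
proof -
  define q where "q = sqrt (1 + (\<rho> s)\<^sup>2)"
  have q: "q > 0" unfolding q_def by (rule darboux_norm_pos)
  have q2: "q * q = 1 + \<rho> s * \<rho> s"
    by (simp add: q_def power2_eq_square)
  note d\<rho> = smooth_on_has_real_derivative[OF smooth_torsion_ratio assms]
  have "((\<lambda>s. sqrt (1 + (\<rho> s)\<^sup>2)) has_real_derivative \<rho> s * \<rho>' s * inverse q) (at s)"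
    using q d\<rho> unfolding q_def
    by (auto intro!: derivative_eq_intros simp: field_simps)
  from DERIV_inverse'[OF this] q
  have "((\<lambda>s. inverse (sqrt (1 + (\<rho> s)\<^sup>2))) has_real_derivative
      - (\<rho> s * \<rho>' s * inverse q ^ 3)) (at s)"
    unfolding q_def[symmetric] by (simp add: power3_eq_cube ac_simps)
  from has_vector_derivative_scaleR[OF this deriv_darboux[OF assms]]
  have *: "(unit_darboux has_vector_derivative
      inverse q *\<^sub>R (\<rho>' s *\<^sub>R T s) + (- (\<rho> s * \<rho>' s * inverse q ^ 3)) *\<^sub>R darboux s) (at s)"
    unfolding q_def[symmetric] by (simp add: unit_darboux_def[abs_def])
  \<comment> \<open>Over the common factor \<open>1 / q\<^sup>3\<close> the coefficient of \<open>T\<close> is \<open>\<rho>' (q\<^sup>2 - \<rho>\<^sup>2) = \<rho>'\<close>.\<close>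
  have "inverse q ^ 3 * (q * q) = inverse q * (inverse q * q) * (inverse q * q)"
    by (simp only: power3_eq_cube ac_simps)
  then have "inverse q = inverse q ^ 3 * (q * q)" using q by simp
  then have "inverse q = inverse q ^ 3 * (1 + \<rho> s * \<rho> s)" unfolding q2 .
  then have "inverse q *\<^sub>R (\<rho>' s *\<^sub>R T s) = (\<rho>' s * inverse q ^ 3 * (1 + \<rho> s * \<rho> s)) *\<^sub>R T s"
    by (metis mult.assoc mult.commute scaleR_scaleR)
  then have "inverse q *\<^sub>R (\<rho>' s *\<^sub>R T s) + (- (\<rho> s * \<rho>' s * inverse q ^ 3)) *\<^sub>R darboux s
    = (\<rho>' s * inverse q ^ 3) *\<^sub>R (T s - \<rho> s *\<^sub>R B s)"
    by (simp add: darboux_def algebra_simps)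
  with * show ?thesis unfolding q_def by simp
qed

text \<open>The rectifying curve is the edge of regression, parametrized by the arclength
  \<open>u = E \<bullet> (edge - p)\<close> with \<open>E\<close> the unit Darboux vector. On the ruling, \<open>\<gamma>\<close> lies at signed distance
  \<open>norm W / \<rho>'\<close> from the edge, which determines the second surface coordinate \<open>v\<close>. The
  acceleration \<open>\<kappa> N\<close> of \<open>\<gamma>\<close> is orthogonal to the tangent plane because that plane is spanned by
  \<open>E\<close> and \<open>E'\<close>, both in the span of \<open>T\<close> and \<open>B\<close>.\<close>

lemma geodesic_if_regular:
  assumes c: "\<And>s. s \<in> I \<Longrightarrow> N s \<bullet> (\<gamma> s - p) = c"
    and r1: "\<And>s. s \<in> I \<Longrightarrow> \<rho>' s \<noteq> 0" and r2: "\<And>s. s \<in> I \<Longrightarrow> \<rho>'' s \<noteq> 0"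
  shows "\<exists>\<alpha> L. rectifying_curve \<alpha> L \<and> congruent_to_tangent_surface_geodesic \<gamma> I \<alpha> L"
proof -
  define q where "q s = sqrt (1 + (\<rho> s)\<^sup>2)" for s
  have q: "q s > 0" "q s \<noteq> 0" for s
    using darboux_norm_pos[of s] by (simp_all add: q_def less_imp_neq[symmetric])
  have darboux_eq: "darboux s = q s *\<^sub>R unit_darboux s" for s
    using q[of s] by (simp add: unit_darboux_def q_def)
  define E' where "E' s = (\<rho>' s * inverse (q s) ^ 3) *\<^sub>R (T s - \<rho> s *\<^sub>R B s)" for s
  have dE: "(unit_darboux has_vector_derivative E' s) (at s)" if "s \<in> I" for s
    using deriv_unit_darboux[OF that] by (simp add: E'_def q_def)
  have E'_nz: "E' s \<noteq> 0" if "s \<in> I" for s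
  proof
    assume "E' s = 0"
    then have "T s \<bullet> (T s - \<rho> s *\<^sub>R B s) = 0" using r1[OF that] q[of s] by (simp add: E'_def)
    then show False using frame_inner[OF that] by (simp add: inner_diff_right)
  qed
  have E'_N: "N s \<bullet> E' s = 0" if "s \<in> I" for s
    using frame_inner[OF that] by (simp add: E'_def inner_diff_right)
  have orth: "(edge s - p) \<bullet> E' s = 0" if "s \<in> I" for s
  proof -
    have "darboux s \<bullet> (T s - \<rho> s *\<^sub>R B s) = 0"
      using frame_inner[OF that] by (simp add: darboux_def inner_diff_right inner_add_left)
    moreover have "edge s - p = (\<gamma> s - p) - inverse (\<rho>' s) *\<^sub>R darboux s" by (simp add: edge_def)
    ultimately show ?thesis
      using concircular_position[OF c that] by (simp add: E'_def inner_diff_left)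
  qed
  \<comment> \<open>The tangential component of the position vector of a rectifying curve is its arclength.\<close>
  define u where "u s = unit_darboux s \<bullet> (edge s - p)" for s
  have u_smooth: "smooth_on I u"
  proof -
    have "smooth_on I (\<lambda>s. unit_darboux s \<bullet> (edge s + (- p)))"
      by (intro smooth_on_inner smooth_on_add smooth_on_const open_I smooth_unit_darboux
          smooth_edge r1)
    then show ?thesis by (simp add: u_def[abs_def])
  qed
  have vderiv_u: "vderiv u s = \<rho>'' s / (\<rho>' s)\<^sup>2 * q s" if "s \<in> I" for s
  proof (rule vderivI)
    have "((\<lambda>s. edge s - p) has_vector_derivative (\<rho>'' s / (\<rho>' s)\<^sup>2) *\<^sub>R darboux s) (at s)"
      using deriv_edge[OF that r1[OF that]] by (simp add: has_vector_derivative_diff_const)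
    from has_vector_derivative_inner[OF dE[OF that] this]
    show "(u has_vector_derivative \<rho>'' s / (\<rho>' s)\<^sup>2 * q s) (at s)"
      using orth[OF that] norm_unit_darboux[OF that]
      by (simp add: u_def[abs_def] darboux_eq norm_eq_1 inner_commute)
  qed
  have u_nz: "vderiv u s \<noteq> 0" if "s \<in> I" for s
    using vderiv_u[OF that] r1[OF that] r2[OF that] q[of s] by simp
  have dA: "(edge has_vector_derivative vderiv u s *\<^sub>R unit_darboux s) (at s)" if "s \<in> I" for s
    using deriv_edge[OF that r1[OF that]] by (simp add: vderiv_u[OF that] darboux_eq)
  obtain \<alpha> where \<alpha>: "frenet_curve \<alpha> (u ` I)"
    and \<alpha>u: "\<And>s. s \<in> I \<Longrightarrow> \<alpha> (u s) = edge s"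
    and T\<alpha>: "\<And>s. s \<in> I \<Longrightarrow> frenet_T \<alpha> (u s) = unit_darboux s"
    and T'\<alpha>: "\<And>s. s \<in> I \<Longrightarrow> vderiv (frenet_T \<alpha>) (u s) = inverse (vderiv u s) *\<^sub>R E' s"
    using unit_speed_reparametrization[OF interval smooth_edge[OF r1] u_smooth u_nz dA
        norm_unit_darboux dE E'_nz] by blast
  interpret \<alpha>: frenet \<alpha> "u ` I" by unfold_locales (rule \<alpha>)

  have "\<alpha> t - p \<in> span {frenet_T \<alpha> t, frenet_B \<alpha> t}" if t: "t \<in> u ` I" for t
  proof -
    obtain s where s: "s \<in> I" "t = u s" using t by blast
    have "(\<alpha> t - p) \<bullet> frenet_N \<alpha> t = 0"
      using orth[OF s(1)] by (simp add: s frenet_N_def \<alpha>u T'\<alpha>)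
    then have eq: "\<alpha> t - p = ((\<alpha> t - p) \<bullet> frenet_T \<alpha> t) *\<^sub>R frenet_T \<alpha> t
        + ((\<alpha> t - p) \<bullet> frenet_B \<alpha> t) *\<^sub>R frenet_B \<alpha> t"
      using \<alpha>.frame_expansion[OF t, of "\<alpha> t - p"] by simp
    have "((\<alpha> t - p) \<bullet> frenet_T \<alpha> t) *\<^sub>R frenet_T \<alpha> t
        + ((\<alpha> t - p) \<bullet> frenet_B \<alpha> t) *\<^sub>R frenet_B \<alpha> t \<in> span {frenet_T \<alpha> t, frenet_B \<alpha> t}"
      by (intro span_add span_scale span_base) auto
    then show ?thesis by (simp only: eq[symmetric])
  qed
  then have rect: "rectifying_curve \<alpha> (u ` I)"
    using \<alpha> by (auto simp: rectifying_curve_def)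

  define v where "v s = u s + inverse (\<rho>' s) * q s" for s
  have v_smooth: "smooth_on I v"
    unfolding v_def[abs_def] q_def
    by (intro smooth_on_add smooth_on_mult smooth_on_inverse smooth_on_vderiv open_I
        u_smooth smooth_torsion_ratio smooth_darboux_norm r1)
  have "(u s, v s) \<in> tangent_surface_dom (u ` I) \<and> \<gamma> s = tangent_surface \<alpha> (u s) (v s) \<and>
      vderiv (vderiv \<gamma>) s \<bullet> vderiv (\<lambda>x. tangent_surface \<alpha> x (v s)) (u s) = 0 \<and>
      vderiv (vderiv \<gamma>) s \<bullet> vderiv (\<lambda>y. tangent_surface \<alpha> (u s) y) (v s) = 0"
    if s: "s \<in> I" for s
  proof -
    have us: "u s \<in> u ` I" using s by simp
    have acc: "vderiv (vderiv \<gamma>) s = \<kappa> s *\<^sub>R N s"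
      using vderivI[OF deriv_T[OF s]] by (simp add: frenet_T_def)
    have dir: "N s \<bullet> unit_darboux s = 0"
      using darboux_inner(2)[OF s] by (simp add: unit_darboux_def inner_commute)
    note partials = tangent_surface_partials[OF smooth_on_differentiable[OF \<alpha>.smooth_curve us]
        smooth_on_differentiable[OF \<alpha>.smooth_T us]]
    have "\<gamma> s = tangent_surface \<alpha> (u s) (v s)"
      by (simp add: tangent_surface_def \<alpha>u[OF s] T\<alpha>[OF s] v_def edge_def darboux_eq)
    moreover have "v s \<noteq> u s" using r1[OF s] q[of s] by (simp add: v_def)
    ultimately show ?thesis
      using us E'_N[OF s] dir
      by (simp add: tangent_surface_dom_def acc partials T\<alpha>[OF s] T'\<alpha>[OF s])
  qed
  then have "geodesic_of_surface (tangent_surface \<alpha>) (tangent_surface_dom (u ` I)) \<gamma> I"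
    unfolding geodesic_of_surface_def using u_smooth v_smooth by blast
  from congruent_if_geodesic[OF this] rect show ?thesis by blast
qed

end

lemma frenet_curve_subset:
  assumes "frenet_curve \<gamma> I" "open_interval J" "J \<subseteq> I"
  shows "frenet_curve \<gamma> J"
  using assms smooth_on_subset[of I \<gamma> J] by (auto simp: frenet_curve_def)

theorem theorem4p4:
  fixes \<gamma> :: "real \<Rightarrow> real^3" and I :: "real set"
  assumes "frenet_curve \<gamma> I"
    and "fully_immersed \<gamma> I"
    and "proper_concircular_helix \<gamma> I"
  shows "(\<forall>J. open_interval J \<and> J \<subseteq> I \<and> proper_concircular_helix \<gamma> J \<longrightarrow>
            (\<exists>K. open_interval K \<and> K \<subseteq> J \<and>
              (\<exists>\<alpha> L. rectifying_curve \<alpha> L \<and> congruent_to_tangent_surface_geodesic \<gamma> K \<alpha> L)))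
       \<and> (\<forall>J. open_interval J \<and> J \<subseteq> I \<and>
              (\<forall>s\<in>J. deriv (torsion_ratio \<gamma>) s \<noteq> 0 \<and> deriv (deriv (torsion_ratio \<gamma>)) s \<noteq> 0) \<longrightarrow>
            (\<exists>\<alpha> L. rectifying_curve \<alpha> L \<and> congruent_to_tangent_surface_geodesic \<gamma> J \<alpha> L))"
proof -
  obtain \<mu> v l where "l * \<mu> \<noteq> 0"
    and l: "\<And>s. s \<in> I \<Longrightarrow> frenet_N \<gamma> s \<bullet> concircular_field \<mu> v (\<gamma> s) = l"
    using assms(3) by (auto simp: proper_concircular_helix_def concircular_helix_def)
  \<comment> \<open>The zero of the concircular field.\<close>
  define p where "p = - (v /\<^sub>R \<mu>)"
  have field: "concircular_field \<mu> v x = \<mu> *\<^sub>R (x - p)" for x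
    using \<open>l * \<mu> \<noteq> 0\<close> by (simp add: concircular_field_def p_def scaleR_add_right)
  have N: "frenet_N \<gamma> s \<bullet> (\<gamma> s - p) = l / \<mu>" if "s \<in> I" for s
  proof -
    have "(frenet_N \<gamma> s \<bullet> (\<gamma> s - p)) * \<mu> = l"
      using l[OF that] by (simp only: field inner_scaleR_right mult.commute)
    moreover have "\<mu> \<noteq> 0" using \<open>l * \<mu> \<noteq> 0\<close> by auto
    ultimately show ?thesis by (simp add: nonzero_eq_divide_eq)
  qed
  have regular: "\<exists>\<alpha> L. rectifying_curve \<alpha> L \<and> congruent_to_tangent_surface_geodesic \<gamma> J \<alpha> L"
    if J: "open_interval J" "J \<subseteq> I"
      and nz: "\<And>s. s \<in> J \<Longrightarrow> vderiv (torsion_ratio \<gamma>) s \<noteq> 0"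
        "\<And>s. s \<in> J \<Longrightarrow> vderiv (vderiv (torsion_ratio \<gamma>)) s \<noteq> 0" for J
  proof -
    interpret frenet \<gamma> J by unfold_locales (rule frenet_curve_subset[OF assms(1) J])
    have "frenet_N \<gamma> s \<bullet> (\<gamma> s - p) = l / \<mu>" if "s \<in> J" for s
      using N that J(2) by blast
    then show ?thesis using nz by (rule geodesic_if_regular)
  qed
  show ?thesis
  proof (intro conjI allI impI; elim conjE)
    fix J assume J: "open_interval J" "J \<subseteq> I" "proper_concircular_helix \<gamma> J"
    interpret frenet \<gamma> J by unfold_locales (rule frenet_curve_subset[OF assms(1) J(1,2)])
    obtain K where K: "open_interval K" "K \<subseteq> J"
      "\<And>s. s \<in> K \<Longrightarrow> vderiv (torsion_ratio \<gamma>) s \<noteq> 0"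
      "\<And>s. s \<in> K \<Longrightarrow> vderiv (vderiv (torsion_ratio \<gamma>)) s \<noteq> 0"
      using exists_regular_subinterval J(3) unfolding proper_concircular_helix_def by metis
    then show "\<exists>K. open_interval K \<and> K \<subseteq> J \<and>
        (\<exists>\<alpha> L. rectifying_curve \<alpha> L \<and> congruent_to_tangent_surface_geodesic \<gamma> K \<alpha> L)"
      using regular[of K] subset_trans[OF K(2) J(2)] by blast
  next
    fix J assume J: "open_interval J" "J \<subseteq> I"
      and nz: "\<forall>s\<in>J. deriv (torsion_ratio \<gamma>) s \<noteq> 0 \<and> deriv (deriv (torsion_ratio \<gamma>)) s \<noteq> 0"
    interpret frenet \<gamma> J by unfold_locales (rule frenet_curve_subset[OF assms(1) J])
    show "\<exists>\<alpha> L. rectifying_curve \<alpha> L \<and> congruent_to_tangent_surface_geodesic \<gamma> J \<alpha> L"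
      using nz deriv_torsion_ratio deriv_deriv_torsion_ratio by (intro regular[OF J]) auto
  qed
qed

end
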